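(* Let $G$ be a metrizable topological group with a dense subgroup $H$. Then $\mathrm{PK}(H)$ is cofinally equivalent to $\mathrm{PK}(G)$.
   Context: A subset $A$ of a topological group $G$ is precompact if for each neighborhood $U$ of the identity there is a finite $F\subseteq G$ with $A\subseteq FU$. $\mathrm{PK}(G)$ is the family of all precompact subsets of $G$, ordered by inclusion. Groups are not assumed abelian. For partially ordered sets $P,Q$, write $P\preceq Q$ if there is an order preserving $f\colon P\to Q$ whose image is cofinal in $Q$; $P$ and $Q$ are cofinally equivalent if $P\preceq Q$ and $Q\preceq P$. *)

theory Defs
  imports "HOL-Analysis.Analysis" "HOL-Algebra.Coset"
begin

locale topological_group = group G for G (structure) +
  fixes T :: "'a topology"
  assumes topspace_eq: "topspace T = carrier G"
    and continuous_mult: "continuous_map (prod_topology T T) T (\<lambda>(x, y). x \<otimes> y)"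
    and continuous_inv: "continuous_map T T (\<lambda>x. inv x)"

text \<open>A neighbourhood of a point is a set having the point in its interior; it need not be open.\<close>

definition precompact_in :: "('a, 'b) monoid_scheme \<Rightarrow> 'a topology \<Rightarrow> 'a set \<Rightarrow> bool" where
  "precompact_in G T A \<longleftrightarrow> A \<subseteq> carrier G \<and>
     (\<forall>U. U \<subseteq> carrier G \<and> \<one>\<^bsub>G\<^esub> \<in> T interior_of U \<longrightarrow>
        (\<exists>F. finite F \<and> F \<subseteq> carrier G \<and> A \<subseteq> F <#>\<^bsub>G\<^esub> U))"

definition PK :: "('a, 'b) monoid_scheme \<Rightarrow> 'a topology \<Rightarrow> 'a set set" where
  "PK G T = {A. precompact_in G T A}"

text \<open>Partially ordered sets are represented as subsets of a type of class \<open>order\<close>, with the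
  induced order; on families of sets this is inclusion. The library constant \<open>cofinal\<close> asks for
  strictly larger elements and so is not the notion needed here.\<close>

definition cofinal_in :: "'a::order set \<Rightarrow> 'a set \<Rightarrow> bool" where
  "cofinal_in C Q \<longleftrightarrow> C \<subseteq> Q \<and> (\<forall>q\<in>Q. \<exists>c\<in>C. q \<le> c)"

definition cofinally_below :: "'a::order set \<Rightarrow> 'b::order set \<Rightarrow> bool" (infix "\<preceq>\<^sub>c" 50) where
  "P \<preceq>\<^sub>c Q \<longleftrightarrow> (\<exists>f. f ` P \<subseteq> Q \<and> mono_on P f \<and> cofinal_in (f ` P) Q)"

definition cofinally_equivalent :: "'a::order set \<Rightarrow> 'b::order set \<Rightarrow> bool" where
  "cofinally_equivalent P Q \<longleftrightarrow> P \<preceq>\<^sub>c Q \<and> Q \<preceq>\<^sub>c P"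

end

theory Submission imports Defs begin

text \<open>Precompactness of \<open>A\<close> can be tested with finite nets whose centres lie in \<open>A\<close> itself, so it
  does not depend on whether \<open>A\<close> is regarded as a subset of \<open>H\<close> or of \<open>G\<close>. Hence \<open>A \<mapsto> A \<inter> H\<close>
  maps \<open>PK G\<close> onto \<open>PK H\<close>. In the other direction closure in \<open>G\<close> is monotone and preserves
  precompactness. Its image is cofinal: given a precompact \<open>K\<close> and a neighbourhood base
  \<open>W 0, W 1, \<dots>\<close> of the identity with small tails, move a finite \<open>W n\<close>-net of \<open>K\<close> into the dense
  subgroup \<open>H\<close> by an error in \<open>W n\<close>. The union of these perturbed nets is precompact, because all
  but finitely many of them stay close to \<open>K\<close>, and its closure contains \<open>K\<close>.\<close>

section \<open>Open sets, translations and small neighbourhoods of the identity\<close>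

lemma closure_of_meets_open:
  assumes "x \<in> X closure_of A" "openin X N" "x \<in> N"
  shows "\<exists>y\<in>A. y \<in> N"
  using assms by (auto simp: in_closure_of)

context topological_group
begin

lemma openin_carrier: "openin T U \<Longrightarrow> x \<in> U \<Longrightarrow> x \<in> carrier G"
  using openin_subset topspace_eq by blast

lemma continuous_map_mult:
  assumes "continuous_map X T f" "continuous_map X T g"
  shows "continuous_map X T (\<lambda>x. f x \<otimes> g x)"
proof -
  have "continuous_map X (prod_topology T T) (\<lambda>x. (f x, g x))"
    using assms by (simp add: continuous_map_pairwise o_def)
  from continuous_map_compose[OF this continuous_mult] show ?thesis
    by (simp add: o_def)
qed

lemma continuous_map_inv:
  assumes "continuous_map X T f"
  shows "continuous_map X T (\<lambda>x. inv (f x))"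
  using continuous_map_compose[OF assms continuous_inv] by (simp add: o_def)

text \<open>Throughout, \<open>inv c \<otimes> y \<in> U\<close> expresses that \<open>y\<close> is
  \<open>U\<close>-close to the centre \<open>c\<close>. With \<open>a = inv c\<close> the first set
  varies the point around a fixed centre; the second varies the centre for a fixed point. In a
  nonabelian group these are separate facts.\<close>

lemma openin_translation_preimage:
  assumes "a \<in> carrier G" "openin T U"
  shows "openin T {x \<in> carrier G. a \<otimes> x \<in> U}" "openin T {x \<in> carrier G. inv x \<otimes> a \<in> U}"
proof -
  have "continuous_map T T (\<lambda>x. a \<otimes> x)" "continuous_map T T (\<lambda>x. inv x \<otimes> a)"
    using assms(1) by (auto intro!: continuous_map_mult continuous_map_inv simp: topspace_eq)
  from this[THEN openin_continuous_map_preimage, OF assms(2)]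
  show "openin T {x \<in> carrier G. a \<otimes> x \<in> U}" "openin T {x \<in> carrier G. inv x \<otimes> a \<in> U}"
    by (simp_all add: topspace_eq)
qed

text \<open>Continuity of multiplication at \<open>(\<one>, \<one>)\<close> yields a box around this
  pair whose products lie in \<open>U\<close>. The result plays the part of halving epsilon.\<close>

lemma symmetric_neighbourhood:
  assumes "openin T U" "\<one> \<in> U"
  shows "\<exists>V. openin T V \<and> \<one> \<in> V \<and> (\<forall>x\<in>V. inv x \<in> V) \<and> (\<forall>x\<in>V. \<forall>y\<in>V. x \<otimes> y \<in> U)"
proof -
  define S where "S = {p \<in> topspace (prod_topology T T). (\<lambda>(x, y). x \<otimes> y) p \<in> U}"
  have S: "openin (prod_topology T T) S"
    unfolding S_def by (rule openin_continuous_map_preimage[OF continuous_mult assms(1)])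
  have "(\<one>, \<one>) \<in> S"
    using assms(2) by (simp add: S_def topspace_eq)
  then have "\<exists>A B. openin T A \<and> openin T B \<and> \<one> \<in> A \<and> \<one> \<in> B \<and> A \<times> B \<subseteq> S"
    using S by (simp add: openin_prod_topology_alt)
  then obtain A B where AB: "openin T A" "openin T B" "\<one> \<in> A" "\<one> \<in> B" "A \<times> B \<subseteq> S"
    by blast
  define W where "W = A \<inter> B"
  have W: "openin T W" "\<one> \<in> W"
    using AB by (auto simp: W_def)
  \<comment> \<open>Inversion is an involution, so intersecting \<open>W\<close> with its preimage
    under inversion makes it symmetric.\<close>
  have "openin T (W \<inter> {x \<in> carrier G. inv x \<in> W})"
    using W(1) openin_continuous_map_preimage[OF continuous_inv W(1)] by (auto simp: topspace_eq)
  then show ?thesis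
    using W(2) AB(5) by (intro exI[of _ "W \<inter> {x \<in> carrier G. inv x \<in> W}"]) (auto simp: W_def S_def)
qed

section \<open>Precompactness through finite nets\<close>

text \<open>This is the triangle inequality of the left uniformity: closeness of \<open>y\<close> to
  \<open>x\<close> and of \<open>z\<close> to \<open>y\<close> multiply to closeness of
  \<open>z\<close> to \<open>x\<close>.\<close>

lemma inv_mult_cancel_middle:
  assumes "x \<in> carrier G" "y \<in> carrier G" "z \<in> carrier G"
  shows "(inv x \<otimes> y) \<otimes> (inv y \<otimes> z) = inv x \<otimes> z"
  using assms by (simp add: m_assoc inv_closed flip: m_assoc[of y "inv y" z])

text \<open>Solving \<open>a = f \<otimes> u\<close> for \<open>u\<close> turns the covering into a
  net condition. Open sets suffice because the interior of a neighbourhood of the identity is an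
  open neighbourhood inside it.\<close>

lemma precompact_in_iff:
  "precompact_in G T A \<longleftrightarrow> A \<subseteq> carrier G \<and>
     (\<forall>U. openin T U \<and> \<one> \<in> U \<longrightarrow>
        (\<exists>F. finite F \<and> F \<subseteq> carrier G \<and> (\<forall>a\<in>A. \<exists>f\<in>F. inv f \<otimes> a \<in> U)))"
  (is "_ \<longleftrightarrow> _ \<and> ?R")
proof (cases "A \<subseteq> carrier G")
  case True
  have cover: "A \<subseteq> F <#> U \<longleftrightarrow> (\<forall>a\<in>A. \<exists>f\<in>F. inv f \<otimes> a \<in> U)"
    if "F \<subseteq> carrier G" "U \<subseteq> carrier G" for F U
  proof -
    have "a \<in> F <#> U \<longleftrightarrow> (\<exists>f\<in>F. inv f \<otimes> a \<in> U)" if a: "a \<in> carrier G" for a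
    proof
      assume "a \<in> F <#> U"
      then obtain f u where "f \<in> F" "u \<in> U" "a = f \<otimes> u"
        by (auto simp: set_mult_def)
      moreover have "f \<in> carrier G" "u \<in> carrier G"
        using calculation \<open>F \<subseteq> carrier G\<close> \<open>U \<subseteq> carrier G\<close> by auto
      ultimately show "\<exists>f\<in>F. inv f \<otimes> a \<in> U"
        by (metis l_inv l_one inv_closed m_assoc)
    next
      assume "\<exists>f\<in>F. inv f \<otimes> a \<in> U"
      then obtain f where f: "f \<in> F" "inv f \<otimes> a \<in> U"
        by blast
      then have "f \<in> carrier G"
        using \<open>F \<subseteq> carrier G\<close> by auto
      then have "a = f \<otimes> (inv f \<otimes> a)"
        by (metis a r_inv l_one inv_closed m_assoc)
      with f show "a \<in> F <#> U"
        by (auto simp: set_mult_def)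
    qed
    with True show ?thesis
      by (meson subset_eq)
  qed
  have "precompact_in G T A \<longleftrightarrow> ?R"
  proof
    assume *: "precompact_in G T A"
    show ?R
    proof (intro allI impI)
      fix U assume U: "openin T U \<and> \<one> \<in> U"
      then have "U \<subseteq> carrier G" "\<one> \<in> T interior_of U"
        using openin_carrier by (auto simp: interior_of_openin)
      with * cover show "\<exists>F. finite F \<and> F \<subseteq> carrier G \<and> (\<forall>a\<in>A. \<exists>f\<in>F. inv f \<otimes> a \<in> U)"
        unfolding precompact_in_def by metis
    qed
  next
    assume R: ?R
    show "precompact_in G T A"
      unfolding precompact_in_def
    proof (intro conjI allI impI True)
      fix U assume U: "U \<subseteq> carrier G \<and> \<one> \<in> T interior_of U"
      with R obtain F where F: "finite F" "F \<subseteq> carrier G"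
          "\<forall>a\<in>A. \<exists>f\<in>F. inv f \<otimes> a \<in> T interior_of U"
        by (meson openin_interior_of)
      then have "\<forall>a\<in>A. \<exists>f\<in>F. inv f \<otimes> a \<in> U"
        using interior_of_subset by fast
      with F U have "A \<subseteq> F <#> U"
        using cover[of F U] by simp
      with F show "\<exists>F. finite F \<and> F \<subseteq> carrier G \<and> A \<subseteq> F <#> U"
        by blast
    qed
  qed
  with True show ?thesis
    by blast
qed (simp add: precompact_in_def)

lemma precompact_inE:
  assumes "precompact_in G T A" "openin T U" "\<one> \<in> U"
  obtains F where "finite F" "F \<subseteq> carrier G" "\<And>a. a \<in> A \<Longrightarrow> \<exists>f\<in>F. inv f \<otimes> a \<in> U"
proof -
  have "\<exists>F. finite F \<and> F \<subseteq> carrier G \<and> (\<forall>a\<in>A. \<exists>f\<in>F. inv f \<otimes> a \<in> U)"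
    using assms by (simp add: precompact_in_iff)
  with that show ?thesis
    by blast
qed

text \<open>Replacing each centre by a point of \<open>A\<close> that it serves costs one halving of
  \<open>U\<close>. The resulting criterion draws its centres from \<open>A\<close> alone, so it can
  be compared between a subgroup and the whole group.\<close>

lemma precompact_in_iff_inner:
  "precompact_in G T A \<longleftrightarrow> A \<subseteq> carrier G \<and>
     (\<forall>U. openin T U \<and> \<one> \<in> U \<longrightarrow>
        (\<exists>F. finite F \<and> F \<subseteq> A \<and> (\<forall>a\<in>A. \<exists>f\<in>F. inv f \<otimes> a \<in> U)))"
proof
  assume A: "precompact_in G T A"
  then have carr: "A \<subseteq> carrier G"
    by (simp add: precompact_in_def)
  have "\<exists>F. finite F \<and> F \<subseteq> A \<and> (\<forall>a\<in>A. \<exists>f\<in>F. inv f \<otimes> a \<in> U)"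
    if U: "openin T U" "\<one> \<in> U" for U
  proof -
    obtain V where V: "openin T V" "\<one> \<in> V" "\<And>x. x \<in> V \<Longrightarrow> inv x \<in> V"
        "\<And>x y. x \<in> V \<Longrightarrow> y \<in> V \<Longrightarrow> x \<otimes> y \<in> U"
      using symmetric_neighbourhood[OF U] by blast
    obtain F where F: "finite F" "F \<subseteq> carrier G" "\<And>a. a \<in> A \<Longrightarrow> \<exists>f\<in>F. inv f \<otimes> a \<in> V"
      by (rule precompact_inE[OF A V(1,2)]) blast
    from F(3) obtain c where c: "\<And>a. a \<in> A \<Longrightarrow> c a \<in> F" "\<And>a. a \<in> A \<Longrightarrow> inv (c a) \<otimes> a \<in> V"
      by metis
    \<comment> \<open>One point of \<open>A\<close> is kept for each centre in use. The image of
      \<open>A\<close> under \<open>c\<close> lies in the finite set \<open>F\<close>, so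
      \<open>E\<close> is finite.\<close>
    define E where "E = inv_into A c ` c ` A"
    have "finite E"
      using F(1) c(1) by (auto simp: E_def intro: finite_subset)
    moreover have "E \<subseteq> A"
      by (auto simp: E_def intro: inv_into_into)
    moreover have "\<exists>e\<in>E. inv e \<otimes> a \<in> U" if a: "a \<in> A" for a
    proof
      let ?e = "inv_into A c (c a)"
      show "?e \<in> E"
        using a by (auto simp: E_def)
      have e: "?e \<in> A" "c ?e = c a"
        using a by (auto intro: inv_into_into f_inv_into_f)
      have mem: "?e \<in> carrier G" "a \<in> carrier G" "c a \<in> carrier G"
        using a e(1) carr c(1) F(2) by auto
      \<comment> \<open>The points \<open>?e\<close> and \<open>a\<close> share the centre
        \<open>c a\<close>. Symmetry of \<open>V\<close> inverts the first displacement, and the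
        centre then cancels.\<close>
      have "inv (inv (c a) \<otimes> ?e) \<otimes> (inv (c a) \<otimes> a) \<in> U"
        using V(3,4) c(2)[OF a] c(2)[OF e(1)] e(2) by simp
      then show "inv ?e \<otimes> a \<in> U"
        using mem by (simp add: inv_mult_group inv_mult_cancel_middle)
    qed
    ultimately show ?thesis
      by blast
  qed
  with carr show "A \<subseteq> carrier G \<and>
     (\<forall>U. openin T U \<and> \<one> \<in> U \<longrightarrow>
        (\<exists>F. finite F \<and> F \<subseteq> A \<and> (\<forall>a\<in>A. \<exists>f\<in>F. inv f \<otimes> a \<in> U)))"
    by blast
next
  assume "A \<subseteq> carrier G \<and>
     (\<forall>U. openin T U \<and> \<one> \<in> U \<longrightarrow>
        (\<exists>F. finite F \<and> F \<subseteq> A \<and> (\<forall>a\<in>A. \<exists>f\<in>F. inv f \<otimes> a \<in> U)))"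
  then have carr: "A \<subseteq> carrier G"
    and net: "\<And>U. openin T U \<Longrightarrow> \<one> \<in> U \<Longrightarrow>
        \<exists>F. finite F \<and> F \<subseteq> A \<and> (\<forall>a\<in>A. \<exists>f\<in>F. inv f \<otimes> a \<in> U)"
    by simp_all
  show "precompact_in G T A"
    unfolding precompact_in_iff
  proof (intro conjI allI impI carr)
    fix U assume "openin T U \<and> \<one> \<in> U"
    then obtain F where F: "finite F" "F \<subseteq> A" "\<forall>a\<in>A. \<exists>f\<in>F. inv f \<otimes> a \<in> U"
      using net[of U] by blast
    then have "F \<subseteq> carrier G"
      using carr by simp
    with F show "\<exists>F. finite F \<and> F \<subseteq> carrier G \<and> (\<forall>a\<in>A. \<exists>f\<in>F. inv f \<otimes> a \<in> U)"
      by blast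
  qed
qed

section \<open>Subsets and closures of precompact sets\<close>

lemma precompact_in_subset:
  assumes "precompact_in G T A" "B \<subseteq> A"
  shows "precompact_in G T B"
  unfolding precompact_in_iff
proof (intro conjI allI impI)
  show "B \<subseteq> carrier G"
    using assms by (auto simp: precompact_in_def)
  fix U assume U: "openin T U \<and> \<one> \<in> U"
  obtain F where "finite F" "F \<subseteq> carrier G" "\<And>a. a \<in> A \<Longrightarrow> \<exists>f\<in>F. inv f \<otimes> a \<in> U"
    by (rule precompact_inE[OF assms(1) conjunct1[OF U] conjunct2[OF U]]) blast
  with assms(2) show "\<exists>F. finite F \<and> F \<subseteq> carrier G \<and> (\<forall>a\<in>B. \<exists>f\<in>F. inv f \<otimes> a \<in> U)"
    by (intro exI[of _ F]) auto
qed

text \<open>A point of the closure is \<open>V\<close>-close to some \<open>a \<in> A\<close>, which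
  is \<open>V\<close>-close to a centre in \<open>F\<close>. Hence a \<open>V\<close>-net of
  \<open>A\<close> is already a \<open>U\<close>-net of the closure.\<close>

lemma precompact_in_closure_of:
  assumes "precompact_in G T A"
  shows "precompact_in G T (T closure_of A)"
  unfolding precompact_in_iff
proof (intro conjI allI impI)
  show "T closure_of A \<subseteq> carrier G"
    using closure_of_subset_topspace topspace_eq by metis
  fix U assume U: "openin T U \<and> \<one> \<in> U"
  obtain V where V: "openin T V" "\<one> \<in> V" "\<And>x. x \<in> V \<Longrightarrow> inv x \<in> V"
      "\<And>x y. x \<in> V \<Longrightarrow> y \<in> V \<Longrightarrow> x \<otimes> y \<in> U"
    using symmetric_neighbourhood[OF conjunct1[OF U] conjunct2[OF U]] by blast
  obtain F where F: "finite F" "F \<subseteq> carrier G" "\<And>a. a \<in> A \<Longrightarrow> \<exists>f\<in>F. inv f \<otimes> a \<in> V"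
    by (rule precompact_inE[OF assms V(1,2)]) blast
  have "\<exists>f\<in>F. inv f \<otimes> x \<in> U" if cl: "x \<in> T closure_of A" for x
  proof -
    have x: "x \<in> carrier G"
      using that by (simp add: in_closure_of topspace_eq)
    \<comment> \<open>Here the centre \<open>y\<close> varies, so that the point \<open>a\<close>
      found in \<open>A\<close> gives \<open>inv a \<otimes> x\<close>, which composes directly with
      \<open>inv f \<otimes> a\<close>.\<close>
    have "openin T {y \<in> carrier G. inv y \<otimes> x \<in> V}" "x \<in> {y \<in> carrier G. inv y \<otimes> x \<in> V}"
      using openin_translation_preimage(2)[OF x V(1)] x V(2) by auto
    from closure_of_meets_open[OF cl this]
    obtain a where a: "a \<in> A" "a \<in> carrier G" "inv a \<otimes> x \<in> V"
      by blast
    with F obtain f where f: "f \<in> F" "f \<in> carrier G" "inv f \<otimes> a \<in> V"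
      by blast
    with V(4) a x have "inv f \<otimes> x \<in> U"
      by (metis inv_mult_cancel_middle)
    with f show ?thesis
      by blast
  qed
  with F show "\<exists>F. finite F \<and> F \<subseteq> carrier G \<and> (\<forall>x\<in>T closure_of A. \<exists>f\<in>F. inv f \<otimes> x \<in> U)"
    by blast
qed

section \<open>Precompactness in a subgroup\<close>

lemma topological_group_subgroup:
  assumes "subgroup H G"
  shows "topological_group (G\<lparr>carrier := H\<rparr>) (subtopology T H)"
proof -
  interpret H: subgroup H G by fact
  have inv: "inv\<^bsub>G\<lparr>carrier := H\<rparr>\<^esub> x = inv x" if "x \<in> H" for x
    using m_inv_consistent[OF assms that] .
  have top: "topspace (subtopology T H) = H"
    using H.subset by (auto simp: topspace_eq)
  have "continuous_map (prod_topology (subtopology T H) (subtopology T H))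
      (subtopology T H) (\<lambda>(x, y). x \<otimes> y)"
    using top by (auto simp: continuous_map_in_subtopology prod_topology_subtopology
        intro!: continuous_map_from_subtopology continuous_mult)
  moreover have "continuous_map (subtopology T H) (subtopology T H) (\<lambda>x. inv x)"
    using top by (auto simp: continuous_map_in_subtopology
        intro!: continuous_map_from_subtopology continuous_inv)
  then have "continuous_map (subtopology T H) (subtopology T H) (\<lambda>x. inv\<^bsub>G\<lparr>carrier := H\<rparr>\<^esub> x)"
    by (rule continuous_map_eq) (simp add: top inv)
  ultimately show ?thesis
    unfolding topological_group_def topological_group_axioms_def
    using top subgroup_imp_group[OF assms] by simp
qed

text \<open>The inner criterion is applied in both groups. For centres and points in
  \<open>A \<subseteq> H\<close> the inverses agree and \<open>inv f \<otimes> a\<close> lies in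
  \<open>H\<close>, so testing against \<open>U \<inter> H\<close> is the same as testing against
  \<open>U\<close>.\<close>

lemma precompact_in_subgroup_iff:
  assumes "subgroup H G"
  shows "precompact_in (G\<lparr>carrier := H\<rparr>) (subtopology T H) A \<longleftrightarrow> A \<subseteq> H \<and> precompact_in G T A"
proof (cases "A \<subseteq> H")
  case True
  interpret H: subgroup H G by fact
  interpret TH: topological_group "G\<lparr>carrier := H\<rparr>" "subtopology T H"
    by (rule topological_group_subgroup[OF assms])
  have carr: "A \<subseteq> carrier G"
    using True H.subset by simp
  have inH: "inv f \<otimes> a \<in> H" if "f \<in> A" "a \<in> A" for f a
    using that True by blast
  have inv: "inv\<^bsub>G\<lparr>carrier := H\<rparr>\<^esub> f = inv f" if "f \<in> A" for f
    using m_inv_consistent[OF assms] that True by blast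
  have net: "(\<forall>a\<in>A. \<exists>f\<in>F. inv\<^bsub>G\<lparr>carrier := H\<rparr>\<^esub> f \<otimes> a \<in> U \<inter> H) \<longleftrightarrow>
      (\<forall>a\<in>A. \<exists>f\<in>F. inv f \<otimes> a \<in> U)" if "F \<subseteq> A" for F U
  proof (intro ball_cong bex_cong refl)
    fix a f assume "a \<in> A" "f \<in> F"
    with that have "f \<in> A" "a \<in> A" by auto
    then show "inv\<^bsub>G\<lparr>carrier := H\<rparr>\<^esub> f \<otimes> a \<in> U \<inter> H \<longleftrightarrow> inv f \<otimes> a \<in> U"
      using inH inv by simp
  qed
  \<comment> \<open>Open neighbourhoods of the identity in \<open>H\<close> are exactly the traces
    of those in \<open>G\<close>, since \<open>\<one> \<in> H\<close>.\<close>
  have "(\<forall>U. openin (subtopology T H) U \<and> \<one> \<in> U \<longrightarrow> P U) \<longleftrightarrow>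
      (\<forall>U. openin T U \<and> \<one> \<in> U \<longrightarrow> P (U \<inter> H))" for P
  proof -
    have "\<one> \<in> U \<inter> H \<longleftrightarrow> \<one> \<in> U" for U
      using H.one_closed by simp
    then show ?thesis
      unfolding openin_subtopology by metis
  qed
  then show ?thesis
    unfolding TH.precompact_in_iff_inner precompact_in_iff_inner
    using True carr by (simp add: net del: Int_iff cong: conj_cong)
qed (simp add: precompact_in_def)

section \<open>Metrizable groups and approximation from a dense set\<close>

text \<open>Balls around the identity with radii tending to 0 work. Whole tails are required to lie
  in \<open>U\<close> because all perturbed nets of large index must be controlled at once.\<close>

lemma metrizable_neighbourhood_base:
  assumes "metrizable_space T"
  shows "\<exists>W :: nat \<Rightarrow> 'a set. (\<forall>n. openin T (W n) \<and> \<one> \<in> W n) \<and>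
    (\<forall>U. openin T U \<and> \<one> \<in> U \<longrightarrow> (\<exists>N. \<forall>n\<ge>N. W n \<subseteq> U))"
proof -
  obtain M d where "Metric_space M d" and T: "T = Metric_space.mtopology M d"
    using assms by (auto simp: metrizable_space_def)
  interpret Metric_space M d by fact
  have one: "\<one> \<in> M"
    using topspace_eq T by (metis one_closed topspace_mtopology)
  show ?thesis
  \<comment> \<open>With \<open>Suc n\<close> the radius is positive also at \<open>n = 0\<close>,
    where \<open>1 / 0 = 0\<close> would give an empty ball.\<close>
  proof (intro exI[of _ "\<lambda>n. mball \<one> (1 / real (Suc n))"] conjI allI impI)
    show "openin T (mball \<one> (1 / real (Suc n)))" for n
      by (simp add: T)
    show "\<one> \<in> mball \<one> (1 / real (Suc n))" for n
      using one by simp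
    fix U assume "openin T U \<and> \<one> \<in> U"
    then obtain r where r: "r > 0" "mball \<one> r \<subseteq> U"
      unfolding T openin_mtopology by blast
    then obtain N where "1 / real (Suc N) < r"
      using nat_approx_posE by blast
    then have "1 / real (Suc n) \<le> r" if "n \<ge> N" for n
      using that by (smt (verit) frac_le of_nat_0_less_iff of_nat_mono Suc_le_mono zero_less_Suc)
    then show "\<exists>N. \<forall>n\<ge>N. mball \<one> (1 / real (Suc n)) \<subseteq> U"
      using r(2) mball_subset_concentric by blast
  qed
qed

lemma precompact_subset_closure_of_dense:
  assumes "metrizable_space T" "H \<subseteq> carrier G" "T closure_of H = topspace T"
    and K: "precompact_in G T K"
  obtains A where "A \<subseteq> H" "precompact_in G T A" "K \<subseteq> T closure_of A"
proof -
  obtain W :: "nat \<Rightarrow> 'a set" where "(\<forall>n. openin T (W n) \<and> \<one> \<in> W n) \<and>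
      (\<forall>U. openin T U \<and> \<one> \<in> U \<longrightarrow> (\<exists>N. \<forall>n\<ge>N. W n \<subseteq> U))"
    using metrizable_neighbourhood_base[OF assms(1)] by (rule exE)
  then have W: "\<And>n. openin T (W n)" "\<And>n. \<one> \<in> W n"
      "\<And>U. openin T U \<Longrightarrow> \<one> \<in> U \<Longrightarrow> \<exists>N. \<forall>n\<ge>N. W n \<subseteq> U"
    by simp_all
  have K_carr: "K \<subseteq> carrier G"
    using K by (simp add: precompact_in_def)
  \<comment> \<open>The centres are taken inside \<open>K\<close> so that a later net of
    \<open>K\<close> also serves them.\<close>
  have "\<exists>F. finite F \<and> F \<subseteq> K \<and> (\<forall>a\<in>K. \<exists>f\<in>F. inv f \<otimes> a \<in> W n)" for n
    using K W(1,2) by (simp add: precompact_in_iff_inner)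
  then obtain F where F: "\<And>n. finite (F n)" "\<And>n. F n \<subseteq> K"
      "\<And>n a. a \<in> K \<Longrightarrow> \<exists>f\<in>F n. inv f \<otimes> a \<in> W n"
    by metis
  have near: "\<exists>h\<in>H. inv f \<otimes> h \<in> W n" if f: "f \<in> carrier G" for f n
  proof -
    have "openin T {y \<in> carrier G. inv f \<otimes> y \<in> W n}" "f \<in> {y \<in> carrier G. inv f \<otimes> y \<in> W n}"
      using openin_translation_preimage(1)[OF inv_closed[OF f] W(1)] f W(2)[of n] by simp_all
    moreover have "f \<in> T closure_of H"
      using f assms(3) topspace_eq by simp
    ultimately show ?thesis
      using closure_of_meets_open[of f T H "{y \<in> carrier G. inv f \<otimes> y \<in> W n}"] by blast
  qed
  \<comment> \<open>The replacement depends on \<open>n\<close> as well as on \<open>f\<close>: the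
    same point may be a centre at several scales, with a different error allowed at each.\<close>
  define h where "h n f = (SOME x. x \<in> H \<and> inv f \<otimes> x \<in> W n)" for n f
  have h: "h n f \<in> H" "inv f \<otimes> h n f \<in> W n" if "f \<in> carrier G" for n f
    using someI_ex[of "\<lambda>x. x \<in> H \<and> inv f \<otimes> x \<in> W n"] near[OF that, of n]
    by (auto simp: h_def)
  have F_carr: "f \<in> carrier G" if "f \<in> F n" for f n
    using that F(2) K_carr by blast
  have h_carr: "h n f \<in> carrier G" if "f \<in> F n" for f n
    using h(1) F_carr[OF that] assms(2) by blast
  define A where "A = (\<Union>n. h n ` F n)"
  show ?thesis
  proof
    show "A \<subseteq> H"
      using h(1) F_carr by (auto simp: A_def)
    show "precompact_in G T A"
      unfolding precompact_in_iff
    proof (intro conjI allI impI)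
      show A_carr: "A \<subseteq> carrier G"
        using h_carr by (auto simp: A_def)
      fix U assume U: "openin T U \<and> \<one> \<in> U"
      obtain V where V: "openin T V" "\<one> \<in> V" "\<And>x. x \<in> V \<Longrightarrow> inv x \<in> V"
          "\<And>x y. x \<in> V \<Longrightarrow> y \<in> V \<Longrightarrow> x \<otimes> y \<in> U"
        using symmetric_neighbourhood[OF conjunct1[OF U] conjunct2[OF U]] by blast
      obtain N where N: "\<And>n. n \<ge> N \<Longrightarrow> W n \<subseteq> V"
        using W(3)[OF V(1,2)] by blast
      obtain E where E: "finite E" "E \<subseteq> carrier G" "\<And>a. a \<in> K \<Longrightarrow> \<exists>f\<in>E. inv f \<otimes> a \<in> V"
        by (rule precompact_inE[OF K V(1,2)]) blast
      \<comment> \<open>The finitely many points from stages below \<open>N\<close> serve as their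
        own centres. A point \<open>h n f\<close> of a later stage is \<open>V\<close>-close to
        \<open>f \<in> K\<close>, which is \<open>V\<close>-close to a centre in
        \<open>E\<close>.\<close>
      define E' where "E' = E \<union> (\<Union>n<N. h n ` F n)"
      have "\<exists>e\<in>E'. inv e \<otimes> a \<in> U" if "a \<in> A" for a
      proof -
        from that obtain n f where nf: "f \<in> F n" "a = h n f"
          by (auto simp: A_def)
        show ?thesis
        proof (cases "n < N")
          case True
          then have "a \<in> E'" "inv a \<otimes> a \<in> U"
            using nf U h_carr by (auto simp: E'_def)
          then show ?thesis
            by blast
        next
          case False
          then have fa: "inv f \<otimes> a \<in> V"
            using N[of n] h(2)[OF F_carr[OF nf(1)]] nf(2) by auto
          obtain e where e: "e \<in> E" "inv e \<otimes> f \<in> V"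
            using E(3) nf(1) F(2) by blast
          have "(inv e \<otimes> f) \<otimes> (inv f \<otimes> a) \<in> U"
            using V(4) e(2) fa by blast
          moreover have "e \<in> carrier G" "f \<in> carrier G" "a \<in> carrier G"
            using e(1) E(2) F_carr[OF nf(1)] A_carr that by auto
          ultimately have "inv e \<otimes> a \<in> U"
            by (simp add: inv_mult_cancel_middle)
          with e(1) show ?thesis
            by (auto simp: E'_def)
        qed
      qed
      moreover have "finite E'" "E' \<subseteq> carrier G"
        using E(1,2) F(1) h_carr by (auto simp: E'_def)
      ultimately show "\<exists>F. finite F \<and> F \<subseteq> carrier G \<and> (\<forall>a\<in>A. \<exists>f\<in>F. inv f \<otimes> a \<in> U)"
        by blast
    qed
    show "K \<subseteq> T closure_of A"
    proof
      fix k assume k: "k \<in> K"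
      then have k_carr: "k \<in> carrier G"
        using K_carr by blast
      have "\<exists>y. y \<in> A \<and> y \<in> Q" if Q: "k \<in> Q" "openin T Q" for Q
      proof -
        \<comment> \<open>The neighbourhood \<open>Q\<close> of \<open>k\<close> is translated to
          the identity, where the base \<open>W\<close> can be used.\<close>
        have "openin T {x \<in> carrier G. k \<otimes> x \<in> Q}" "\<one> \<in> {x \<in> carrier G. k \<otimes> x \<in> Q}"
          using openin_translation_preimage(1)[OF k_carr Q(2)] k_carr Q(1) by simp_all
        from symmetric_neighbourhood[OF this] obtain V
          where V: "openin T V" "\<one> \<in> V" "\<And>x. x \<in> V \<Longrightarrow> inv x \<in> V"
            "\<And>x y. x \<in> V \<Longrightarrow> y \<in> V \<Longrightarrow> x \<otimes> y \<in> {x \<in> carrier G. k \<otimes> x \<in> Q}"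
          by blast
        obtain n where n: "W n \<subseteq> V"
          using W(3)[OF V(1,2)] by blast
        obtain f where f: "f \<in> F n" "inv f \<otimes> k \<in> W n"
          using F(3)[OF k] by blast
        have carr: "f \<in> carrier G" "h n f \<in> carrier G"
          using f(1) F_carr h_carr by auto
        \<comment> \<open>Both \<open>k\<close> and \<open>h n f\<close> are
          \<open>W n\<close>-close to the same centre \<open>f\<close>; cancelling \<open>f\<close>
          leaves \<open>inv k \<otimes> h n f\<close>.\<close>
        have "inv (inv f \<otimes> k) \<otimes> (inv f \<otimes> h n f) \<in> {x \<in> carrier G. k \<otimes> x \<in> Q}"
          by (intro V(3,4) subsetD[OF n] f(2) h(2) carr)
        then have "k \<otimes> (inv k \<otimes> h n f) \<in> Q"
          using carr k_carr by (simp add: inv_mult_group inv_mult_cancel_middle)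
        then have "h n f \<in> Q"
          using carr k_carr by (metis inv_closed l_one m_assoc r_inv)
        then show ?thesis
          using f(1) by (auto simp: A_def)
      qed
      then show "k \<in> T closure_of A"
        unfolding in_closure_of using k_carr topspace_eq by auto
    qed
  qed
qed

end

section \<open>Closure and trace on \<open>H\<close> as monotone maps with cofinal image\<close>

theorem corollary3p22:
  fixes G :: "('a, 'b) monoid_scheme" and T :: "'a topology" and H :: "'a set"
  assumes "topological_group G T"
    and "metrizable_space T"
    and "subgroup H G"
    and "T closure_of H = topspace T"
  shows "cofinally_equivalent (PK (G\<lparr>carrier := H\<rparr>) (subtopology T H)) (PK G T)"
proof -
  interpret topological_group G T by fact
  \<comment> \<open>Both posets now consist of subsets of \<open>G\<close> with the same notion of
    precompactness, so the two maps need no change of group.\<close>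
  have PK_H: "PK (G\<lparr>carrier := H\<rparr>) (subtopology T H) = {A \<in> PK G T. A \<subseteq> H}"
    using precompact_in_subgroup_iff[OF assms(3)] by (auto simp: PK_def)
  have "{A \<in> PK G T. A \<subseteq> H} \<preceq>\<^sub>c PK G T"
    unfolding cofinally_below_def cofinal_in_def
  proof (intro exI[of _ "\<lambda>A. T closure_of A"] conjI ballI)
    fix K assume "K \<in> PK G T"
    then obtain A where "A \<subseteq> H" "precompact_in G T A" "K \<subseteq> T closure_of A"
      using precompact_subset_closure_of_dense[OF assms(2) subgroup.subset[OF assms(3)] assms(4)]
      by (auto simp: PK_def)
    then show "\<exists>C\<in>(closure_of) T ` {A \<in> PK G T. A \<subseteq> H}. K \<subseteq> C"
      by (auto simp: PK_def)
  qed (auto simp: PK_def precompact_in_closure_of intro!: mono_onI closure_of_mono)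
  moreover have "PK G T \<preceq>\<^sub>c {A \<in> PK G T. A \<subseteq> H}"
    unfolding cofinally_below_def cofinal_in_def
  proof (intro exI[of _ "\<lambda>A. A \<inter> H"] conjI ballI)
    fix B assume "B \<in> {A \<in> PK G T. A \<subseteq> H}"
    \<comment> \<open>Since \<open>B \<inter> H = B\<close>, the set \<open>B\<close> is its own
      image and can be taken as \<open>C\<close>.\<close>
    then show "\<exists>C\<in>(\<lambda>A. A \<inter> H) ` PK G T. B \<subseteq> C"
      by blast
  qed (auto simp: PK_def intro!: mono_onI elim: precompact_in_subset)
  ultimately show ?thesis
    by (simp add: cofinally_equivalent_def PK_H)
qed

end
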